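(* Any cell probe data structure with cell size $w$ bits that uses a memoryless update algorithm to solve (i) reachability in directed graphs on $n$ nodes, (ii) subgraph connectivity in graphs on $n$ nodes, or (iii) range mode on arrays of length $n$, must have query time $t_q=\Omega(n/w)$.
   Context: **Cell probe model.** A data structure consists of a collection of memory cells, each storing $w$ bits and each having an integer address in $[2^w]=\{1,\dots,2^w\}$. In a preprocessing phase the data structure receives an input and initializes its cells (with unrestricted computation). A query algorithm, given a query, probes (reads) cells one at a time; the cell probed at each step may depend arbitrarily on the query and the contents of all cells probed so far (so the query algorithm may be adaptive); after probing some cells it terminates with the answer. An update algorithm, given an update, reads and/or writes cells (both are called probing). Only probes are charged: the query time $t_q$ is the (worst-case) number of cells probed when answering a query. Data structures are deterministic and always correct. **Memoryless update algorithm.** The update algorithm is non-adaptive, i.e. the cells it probes when processing an update depend only on the update and not on the contents of previously probed cells; and furthermore the contents written to a cell during an update depend only on the update and the current contents of that cell (not on the contents of other cells probed during the update). **Reachability in directed graphs.** In a preprocessing phase we are given a directed graph with $n$ nodes and $m$ edges. Updates insert directed edges into the graph. A query is specified by two nodes $u,v$, and asks whether there is a directed path from $u$ to $v$. **Subgraph connectivity.** In a preprocessing phase we are given an undirected graph with $n$ nodes and $m$ edges. Updates turn nodes on and off. A query is specified by two nodes $u,v$, and asks whether there is a path from $u$ to $v$ using only on nodes. **Range mode.** In a preprocessing phase we are given an array $A[1:n]$ of integers. Updates are value updates $A[i]\leftarrow A[i]+x$. A query is specified by two indices $i$ and $j$, and asks for the most frequently occurring integer in the subarray $A[i:j]$.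 **Asymptotics.** The data structures must work for all inputs of the respective problem with parameter $n$ (for the graph problems, with any number $m$ of edges). The $\Omega(\cdot)$ hides an absolute positive constant, independent of $n$, $w$ and the data structure. *)

theory Defs
  imports Complex_Main "HOL-Library.FuncSet" "HOL-Library.Extended_Real"
begin

section \<open>The cell probe model\<close>

type_synonym word_bits = "bool list"
type_synonym memory = "nat \<Rightarrow> word_bits"

definition addresses :: "nat \<Rightarrow> nat set" where
  "addresses w = {1..2 ^ w}"

definition cell_words :: "nat \<Rightarrow> word_bits set" where
  "cell_words w = {b. length b = w}"

definition memories :: "nat \<Rightarrow> memory set" where
  "memories w = addresses w \<rightarrow> cell_words w"

text \<open>
  A query algorithm, once the query is fixed, is a decision tree: the next probe (or the answer)
  is an arbitrary function of the contents seen so far. An update algorithm is such a tree that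
  may also write.
\<close>

datatype 'r query_tree =
  Answer 'r
| Probe nat "word_bits \<Rightarrow> 'r query_tree"

primrec query_result :: "'r query_tree \<Rightarrow> memory \<Rightarrow> 'r" where
  "query_result (Answer r) M = r"
| "query_result (Probe a k) M = query_result (k (M a)) M"

primrec query_probes :: "'r query_tree \<Rightarrow> memory \<Rightarrow> nat" where
  "query_probes (Answer r) M = 0"
| "query_probes (Probe a k) M = Suc (query_probes (k (M a)) M)"

primrec wf_query :: "nat \<Rightarrow> 'r query_tree \<Rightarrow> bool" where
  "wf_query w (Answer r) \<longleftrightarrow> True"
| "wf_query w (Probe a k) \<longleftrightarrow> a \<in> addresses w \<and> (\<forall>b \<in> cell_words w. wf_query w (k b))"

datatype update_tree =
  Done
| Read nat "word_bits \<Rightarrow> update_tree"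
| Write nat word_bits update_tree

primrec run_update :: "update_tree \<Rightarrow> memory \<Rightarrow> memory" where
  "run_update Done M = M"
| "run_update (Read a k) M = run_update (k (M a)) M"
| "run_update (Write a b t) M = run_update t (M(a := b))"

primrec update_probed :: "update_tree \<Rightarrow> memory \<Rightarrow> nat set" where
  "update_probed Done M = {}"
| "update_probed (Read a k) M = insert a (update_probed (k (M a)) M)"
| "update_probed (Write a b t) M = insert a (update_probed t (M(a := b)))"

primrec wf_update :: "nat \<Rightarrow> update_tree \<Rightarrow> bool" where
  "wf_update w Done \<longleftrightarrow> True"
| "wf_update w (Read a k) \<longleftrightarrow> a \<in> addresses w \<and> (\<forall>b \<in> cell_words w. wf_update w (k b))"
| "wf_update w (Write a b t) \<longleftrightarrow> a \<in> addresses w \<and> b \<in> cell_words w \<and> wf_update w t"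

record ('s, 'u, 'q, 'r) data_structure =
  preprocess :: "'s \<Rightarrow> memory"
  update_alg :: "'u \<Rightarrow> update_tree"
  query_alg :: "'q \<Rightarrow> 'r query_tree"

definition wf_data_structure :: "nat \<Rightarrow> ('s, 'u, 'q, 'r) data_structure \<Rightarrow> bool" where
  "wf_data_structure w D \<longleftrightarrow>
     (\<forall>s. preprocess D s \<in> memories w) \<and>
     (\<forall>u. wf_update w (update_alg D u)) \<and>
     (\<forall>q. wf_query w (query_alg D q))"

definition memoryless :: "nat \<Rightarrow> ('s, 'u, 'q, 'r) data_structure \<Rightarrow> bool" where
  "memoryless w D \<longleftrightarrow>
     (\<forall>u. \<forall>M \<in> memories w. \<forall>M' \<in> memories w.
        update_probed (update_alg D u) M = update_probed (update_alg D u) M' \<and>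
        (\<forall>a \<in> update_probed (update_alg D u) M.
           M a = M' a \<longrightarrow> run_update (update_alg D u) M a = run_update (update_alg D u) M' a))"

section \<open>Dynamic problems\<close>

text \<open>
  The preprocessing input is the initial state. The set of correct answers may have several
  elements, as for modes with ties.
\<close>

record ('s, 'u, 'q, 'r) dynamic_problem =
  inputs :: "'s set"
  legal_updates :: "'s \<Rightarrow> 'u set"
  apply_update :: "'s \<Rightarrow> 'u \<Rightarrow> 's"
  queries :: "'q set"
  correct_answers :: "'s \<Rightarrow> 'q \<Rightarrow> 'r set"

inductive_set configurations ::
  "('s, 'u, 'q, 'r) dynamic_problem \<Rightarrow> ('s, 'u, 'q, 'r) data_structure \<Rightarrow> ('s \<times> memory) set"
  for P :: "('s, 'u, 'q, 'r) dynamic_problem" and D :: "('s, 'u, 'q, 'r) data_structure" where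
  initial: "s \<in> inputs P \<Longrightarrow> (s, preprocess D s) \<in> configurations P D"
| update: "(s, M) \<in> configurations P D \<Longrightarrow> u \<in> legal_updates P s \<Longrightarrow>
    (apply_update P s u, run_update (update_alg D u) M) \<in> configurations P D"

definition solves ::
  "('s, 'u, 'q, 'r) data_structure \<Rightarrow> ('s, 'u, 'q, 'r) dynamic_problem \<Rightarrow> bool" where
  "solves D P \<longleftrightarrow>
     (\<forall>(s, M) \<in> configurations P D. \<forall>q \<in> queries P.
        query_result (query_alg D q) M \<in> correct_answers P s q)"

definition query_time ::
  "('s, 'u, 'q, 'r) dynamic_problem \<Rightarrow> ('s, 'u, 'q, 'r) data_structure \<Rightarrow> enat" where
  "query_time P D =
     (SUP ((s, M), q) \<in> configurations P D \<times> queries P. enat (query_probes (query_alg D q) M))"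

section \<open>The three problems\<close>

text \<open>Directed graphs on the nodes \<open>{1..n}\<close>, without loops; only absent edges are inserted.\<close>

definition reachability ::
  "nat \<Rightarrow> ((nat \<times> nat) set, nat \<times> nat, nat \<times> nat, bool) dynamic_problem" where
  "reachability n =
     \<lparr>inputs = {E. E \<subseteq> {1..n} \<times> {1..n} - Id},
      legal_updates = (\<lambda>E. ({1..n} \<times> {1..n} - Id) - E),
      apply_update = (\<lambda>E e. insert e E),
      queries = {1..n} \<times> {1..n},
      correct_answers = (\<lambda>E (u, v). {(u, v) \<in> E\<^sup>*})\<rparr>"

text \<open>
  A state is an edge set together with the set of on nodes. Initially the on nodes are \<open>S0\<close>,
  independently of the input graph; all on is \<open>S0 = {1..n}\<close> and all off is \<open>S0 = {}\<close>.
  The endpoints of a path belong to it, so they must be on as well.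
\<close>

datatype switch = Turn_On nat | Turn_Off nat

fun apply_switch :: "nat set \<Rightarrow> switch \<Rightarrow> nat set" where
  "apply_switch S (Turn_On v) = insert v S"
| "apply_switch S (Turn_Off v) = S - {v}"

definition connected_within :: "nat set set \<Rightarrow> nat set \<Rightarrow> nat \<Rightarrow> nat \<Rightarrow> bool" where
  "connected_within E S u v \<longleftrightarrow>
     u \<in> S \<and> v \<in> S \<and> (u, v) \<in> {(a, b). {a, b} \<in> E \<and> a \<in> S \<and> b \<in> S}\<^sup>*"

definition subgraph_connectivity ::
  "nat \<Rightarrow> nat set \<Rightarrow> (nat set set \<times> nat set, switch, nat \<times> nat, bool) dynamic_problem" where
  "subgraph_connectivity n S0 =
     \<lparr>inputs = {E. E \<subseteq> {e. e \<subseteq> {1..n} \<and> card e = 2}} \<times> {S0},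
      legal_updates = (\<lambda>(E, S). Turn_On ` ({1..n} - S) \<union> Turn_Off ` S),
      apply_update = (\<lambda>(E, S) x. (E, apply_switch S x)),
      queries = {1..n} \<times> {1..n},
      correct_answers = (\<lambda>(E, S) (u, v). {connected_within E S u v})\<rparr>"

definition range_modes :: "(nat \<Rightarrow> int) \<Rightarrow> nat \<Rightarrow> nat \<Rightarrow> int set" where
  "range_modes A i j =
     {x. \<forall>y. card {k \<in> {i..j}. A k = y} \<le> card {k \<in> {i..j}. A k = x}}"

text \<open>
  Array entries range over \<open>V\<close>, and updates must keep them there. With \<open>V = UNIV\<close> no data structure
  with finitely many finite cells is correct, so bounded \<open>V\<close> is the interesting case.
\<close>

definition range_mode ::
  "nat \<Rightarrow> int set \<Rightarrow> (nat \<Rightarrow> int, nat \<times> int, nat \<times> nat, int) dynamic_problem" where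
  "range_mode n V =
     \<lparr>inputs = {1..n} \<rightarrow>\<^sub>E V,
      legal_updates = (\<lambda>A. {(i, x). i \<in> {1..n} \<and> A i + x \<in> V}),
      apply_update = (\<lambda>A (i, x). A(i := A i + x)),
      queries = {(i, j). 1 \<le> i \<and> i \<le> j \<and> j \<le> n},
      correct_answers = (\<lambda>A (i, j). range_modes A i j)\<rparr>"

end

theory Submission
  imports Defs
begin

text \<open>
  After a fixed sequence of memoryless updates, the content of each cell is a function of the
  updates and of the initial content of that same cell. If \<open>x\<close> determines the input and \<open>y\<close> the
  updates, then a query is a two-party protocol in which each probe costs \<open>2 w\<close> bits: the initial and
  the final content of the probed cell. If \<open>2^m\<close> pairs \<open>(x, x)\<close> form a fooling set, then \<open>m \<le> 2 w t\<close>.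
  In all three problems the fooling set comes from set disjointness, with \<open>x\<close> a set and the updates
  encoding the complement of \<open>y\<close>.
\<close>

section \<open>Locality of memoryless updates\<close>

abbreviation run_updates :: "('s, 'u, 'q, 'r) data_structure \<Rightarrow> 'u list \<Rightarrow> memory \<Rightarrow> memory" where
  "run_updates D us M \<equiv> foldl (\<lambda>M u. run_update (update_alg D u) M) M us"

lemma run_update_memories:
  assumes "wf_update w T" "M \<in> memories w"
  shows "run_update T M \<in> memories w"
  using assms by (induction T arbitrary: M) (auto simp: memories_def Pi_iff)

lemma run_update_unprobed:
  assumes "a \<notin> update_probed T M"
  shows "run_update T M a = M a"
  using assms by (induction T arbitrary: M) auto

lemma run_updates_memories:
  assumes "wf_data_structure w D" "M \<in> memories w"
  shows "run_updates D us M \<in> memories w"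
  using assms(2)
  by (induction us arbitrary: M) (use assms(1) in \<open>auto simp: wf_data_structure_def run_update_memories\<close>)

text \<open>Both memories give the same set of probed cells. So either memorylessness covers
  \<open>a\<close>, or \<open>a\<close> is left untouched in both runs.\<close>

lemma memoryless_run_update_cong:
  assumes "memoryless w D" "M \<in> memories w" "M' \<in> memories w" "M a = M' a"
  shows "run_update (update_alg D u) M a = run_update (update_alg D u) M' a"
proof (cases "a \<in> update_probed (update_alg D u) M")
  case True
  then show ?thesis using assms unfolding memoryless_def by blast
next
  case False
  moreover from this have "a \<notin> update_probed (update_alg D u) M'"
    using assms(1-3) unfolding memoryless_def by blast
  ultimately show ?thesis by (simp add: run_update_unprobed assms(4))
qed

lemma memoryless_run_updates_cong:
  assumes "wf_data_structure w D" "memoryless w D"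
    and "M \<in> memories w" "M' \<in> memories w" "M a = M' a"
  shows "run_updates D us M a = run_updates D us M' a"
  using assms(3-5)
proof (induction us arbitrary: M M')
  case (Cons u us)
  have "wf_update w (update_alg D u)"
    using assms(1) by (simp add: wf_data_structure_def)
  then show ?case
    using Cons memoryless_run_update_cong[OF assms(2) Cons.prems]
    by (simp add: run_update_memories)
qed simp

section \<open>The fooling set bound\<close>

lemma finite_cell_words: "finite (cell_words w)"
  and card_cell_words: "card (cell_words w) = 2 ^ w"
  using finite_lists_length_eq[of "UNIV :: bool set" w] card_lists_length_eq[of "UNIV :: bool set" w]
  by (simp_all add: cell_words_def)

text \<open>Rectangle argument along the tree. \<open>F\<close> is classified by the initial and
  final content of the probed cell in the diagonal runs \<open>M x x\<close>, which gives at most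
  \<open>2 ^ (2 * w)\<close> classes. Within a class, locality makes a mixed run
  \<open>M x y\<close> agree with \<open>M y y\<close> on that cell, so all four runs of any pair
  enter the same subtree. Hence a probe bound on diagonal runs suffices. At a leaf all answers
  coincide, so at most one element remains.\<close>

lemma fooling_set_card_query_tree:
  fixes I :: "'x \<Rightarrow> memory" and M :: "'x \<Rightarrow> 'x \<Rightarrow> memory"
  assumes "finite F" "wf_query w T"
    and "\<And>x. x \<in> F \<Longrightarrow> I x \<in> memories w"
    and "\<And>x. x \<in> F \<Longrightarrow> M x x \<in> memories w"
    and "\<And>x x' y a. x \<in> F \<Longrightarrow> x' \<in> F \<Longrightarrow> y \<in> F \<Longrightarrow> I x a = I x' a \<Longrightarrow> M x y a = M x' y a"
    and "\<And>x. x \<in> F \<Longrightarrow> query_probes T (M x x) \<le> t"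
    and "\<And>x y. x \<in> F \<Longrightarrow> y \<in> F \<Longrightarrow> x \<noteq> y \<Longrightarrow>
           \<not> (\<exists>r. \<forall>x' \<in> {x, y}. \<forall>y' \<in> {x, y}. query_result T (M x' y') = r)"
  shows "card F \<le> 2 ^ (2 * w * t)"
  using assms
proof (induction T arbitrary: F t)
  case (Answer r)
  have "x = y" if "x \<in> F" "y \<in> F" for x y
    using Answer.prems(7)[OF that] by auto
  then have "card F \<le> 1"
    using Answer.prems(1) by (simp add: card_le_Suc0_iff_eq)
  also have "1 \<le> (2::nat) ^ (2 * w * t)" by simp
  finally show ?case .
next
  case (Probe a k)
  show ?case
  proof (cases "F = {}")
    case False
    \<comment> \<open>A diagonal run of any member of \<open>F\<close> makes the probe at the root,
      so \<open>t\<close> is positive.\<close>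
    then obtain t' where t: "t = Suc t'"
      using Probe.prems(6) by (cases t) auto
    have a: "a \<in> addresses w" and k: "\<And>b. b \<in> cell_words w \<Longrightarrow> wf_query w (k b)"
      using Probe.prems(2) by auto
    let ?W = "cell_words w \<times> cell_words w"
    define C where "C p = {x \<in> F. (I x a, M x x a) = p}" for p
    have cover: "F \<subseteq> (\<Union>p \<in> ?W. C p)"
      using Probe.prems(3,4) a by (fastforce simp: C_def memories_def Pi_iff)
    have bound: "card (C p) \<le> 2 ^ (2 * w * t')" if p: "p \<in> ?W" for p
    proof -
      obtain b b' where p_eq: "p = (b, b')" and b': "b' \<in> cell_words w"
        using p by auto
      have same: "M x y a = b'" if "x \<in> C p" "y \<in> C p" for x y
        using Probe.prems(5)[of x y y a] that by (auto simp: C_def p_eq)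
      have res: "query_result (Probe a k) (M x y) = query_result (k b') (M x y)"
        if "x \<in> C p" "y \<in> C p" for x y
        using same[OF that] by simp
      have sub: "C p \<subseteq> F" by (auto simp: C_def)
      show ?thesis
      proof (rule Probe.IH[of "k b'"])
        show "query_probes (k b') (M x x) \<le> t'" if "x \<in> C p" for x
          using Probe.prems(6)[of x] same[OF that that] that sub by (auto simp: t)
        show "\<not> (\<exists>r. \<forall>x' \<in> {x, y}. \<forall>y' \<in> {x, y}. query_result (k b') (M x' y') = r)"
          if "x \<in> C p" "y \<in> C p" "x \<noteq> y" for x y
        proof
          assume "\<exists>r. \<forall>x' \<in> {x, y}. \<forall>y' \<in> {x, y}. query_result (k b') (M x' y') = r"
          then obtain r where "\<forall>x' \<in> {x, y}. \<forall>y' \<in> {x, y}. query_result (k b') (M x' y') = r" ..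
          then have "\<forall>x' \<in> {x, y}. \<forall>y' \<in> {x, y}. query_result (Probe a k) (M x' y') = r"
            using res that(1,2) by simp
          then show False
            using Probe.prems(7)[OF subsetD[OF sub that(1)] subsetD[OF sub that(2)] that(3)] by blast
        qed
        show "finite (C p)"
          by (rule finite_subset[OF sub Probe.prems(1)])
        show "k b' \<in> range k" by simp
        show "wf_query w (k b')" by (rule k[OF b'])
        show "I x \<in> memories w" "M x x \<in> memories w" if "x \<in> C p" for x
          using Probe.prems(3,4) that sub by auto
        show "M x y a' = M x' y a'" if "x \<in> C p" "x' \<in> C p" "y \<in> C p" "I x a' = I x' a'" for x x' y a'
          using Probe.prems(5) that sub by blast
      qed
    qed
    have fin: "finite (C p)" for p
      using Probe.prems(1) by (simp add: C_def)
    have "card F \<le> card (\<Union>p \<in> ?W. C p)"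
      using cover fin by (intro card_mono) (auto simp: finite_cell_words)
    also have "\<dots> \<le> (\<Sum>p \<in> ?W. card (C p))"
      by (rule card_UN_le) (simp add: finite_cell_words)
    also have "\<dots> \<le> card ?W * 2 ^ (2 * w * t')"
      using sum_bounded_above[of ?W "\<lambda>p. card (C p)"] bound by simp
    also have "\<dots> = 2 ^ (2 * w * t)"
      by (simp add: card_cartesian_product card_cell_words t power_add mult_2)
    finally show ?thesis .
  qed simp
qed

section \<open>From query trees to dynamic problems\<close>

primrec legal_run ::
  "('s, 'u, 'q, 'r) dynamic_problem \<Rightarrow> 's \<Rightarrow> 'u list \<Rightarrow> 's \<Rightarrow> bool" where
  "legal_run P s [] s' \<longleftrightarrow> s = s'"
| "legal_run P s (u # us) s' \<longleftrightarrow> u \<in> legal_updates P s \<and> legal_run P (apply_update P s u) us s'"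

lemma configurations_run_updates:
  assumes "(s, M) \<in> configurations P D" "legal_run P s us s'"
  shows "(s', run_updates D us M) \<in> configurations P D"
  using assms by (induction us arbitrary: s M) (auto intro: configurations.update)

text \<open>The input \<open>s x\<close> depends on \<open>x\<close> alone and the updates
  \<open>us y\<close> on \<open>y\<close> alone, which is what lets locality compare mixed runs. As
  a query may have several correct answers, fooling means that no single \<open>r\<close> is correct
  for all four combinations of \<open>x\<close> and \<open>y\<close>.\<close>

lemma fooling_set_card:
  assumes wf: "wf_data_structure w D" and ml: "memoryless w D" and sol: "solves D P"
    and time: "query_time P D \<le> enat t"
    and fin: "finite F" and q: "q \<in> queries P"
    and init: "\<And>x. x \<in> F \<Longrightarrow> s x \<in> inputs P"
    and run: "\<And>x y. x \<in> F \<Longrightarrow> y \<in> F \<Longrightarrow> legal_run P (s x) (us y) (fs x y)"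
    and fool: "\<And>x y r. x \<in> F \<Longrightarrow> y \<in> F \<Longrightarrow> x \<noteq> y \<Longrightarrow>
         \<forall>x' \<in> {x, y}. \<forall>y' \<in> {x, y}. r \<in> correct_answers P (fs x' y') q \<Longrightarrow> False"
  shows "card F \<le> 2 ^ (2 * w * t)"
proof (rule fooling_set_card_query_tree)
  let ?I = "\<lambda>x. preprocess D (s x)"
  let ?M = "\<lambda>x y. run_updates D (us y) (?I x)"
  let ?T = "query_alg D q"
  have conf: "(fs x y, ?M x y) \<in> configurations P D" if "x \<in> F" "y \<in> F" for x y
    by (rule configurations_run_updates[OF configurations.initial[OF init[OF that(1)]] run[OF that]])
  have correct: "query_result ?T (?M x y) \<in> correct_answers P (fs x y) q"
    if "x \<in> F" "y \<in> F" for x y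
    using sol conf[OF that] q unfolding solves_def by blast
  show mem: "?I x \<in> memories w" for x
    using wf by (simp add: wf_data_structure_def)
  show "?M x y \<in> memories w" for x y
    by (rule run_updates_memories[OF wf mem])
  show "?M x y a = ?M x' y a" if "?I x a = ?I x' a" for x x' y a
    by (rule memoryless_run_updates_cong[OF wf ml mem mem that])
  show "query_probes ?T (?M x x) \<le> t" if "x \<in> F" for x
  proof -
    have "enat (query_probes ?T (?M x x)) \<le> query_time P D"
      unfolding query_time_def
      by (rule SUP_upper2[of "((fs x x, ?M x x), q)"]) (use conf that q in auto)
    with time show ?thesis
      by (metis enat_ord_simps(1) order_trans)
  qed
  show "\<not> (\<exists>r. \<forall>x' \<in> {x, y}. \<forall>y' \<in> {x, y}. query_result ?T (?M x' y') = r)"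
    if "x \<in> F" "y \<in> F" "x \<noteq> y" for x y
  proof
    assume "\<exists>r. \<forall>x' \<in> {x, y}. \<forall>y' \<in> {x, y}. query_result ?T (?M x' y') = r"
    then obtain r where r: "\<forall>x' \<in> {x, y}. \<forall>y' \<in> {x, y}. query_result ?T (?M x' y') = r" ..
    have "r \<in> correct_answers P (fs x' y') q" if "x' \<in> {x, y}" "y' \<in> {x, y}" for x' y'
    proof -
      have "query_result ?T (?M x' y') = r" using r that by blast
      moreover have "x' \<in> F" "y' \<in> F" using that \<open>x \<in> F\<close> \<open>y \<in> F\<close> by auto
      ultimately show ?thesis using correct by metis
    qed
    then show False using fool[OF that] by blast
  qed
qed (use fin wf in \<open>auto simp: wf_data_structure_def\<close>)

section \<open>Reachability\<close>

lemma reachability_run: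
  assumes "distinct es" "set es \<subseteq> ({1..n} \<times> {1..n} - Id) - E"
  shows "legal_run (reachability n) E es (E \<union> set es)"
  using assms
proof (induction es arbitrary: E)
  case (Cons e es)
  have "legal_run (reachability n) (insert e E) es (insert e E \<union> set es)"
    by (rule Cons.IH) (use Cons.prems in auto)
  moreover have "insert e E \<union> set es = E \<union> set (e # es)" by auto
  moreover have "e \<in> legal_updates (reachability n) E" "apply_update (reachability n) E e = insert e E"
    using Cons.prems by (auto simp: reachability_def)
  ultimately show ?case by simp
qed simp

text \<open>A path from \<open>u\<close> starts with an edge into \<open>X\<close>. The node reached
  there is \<open>v\<close> itself, or it has an outgoing edge and hence lies in \<open>Y\<close>,
  because \<open>u\<close> is not in \<open>X\<close>. The term \<open>insert v Y\<close> accounts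
  for a direct edge from \<open>u\<close> to \<open>v\<close>.\<close>

lemma two_layer_reachable_iff:
  assumes "u \<noteq> v" "u \<notin> Y" "u \<notin> X" "v \<notin> Y"
  shows "(u, v) \<in> ({u} \<times> X \<union> Y \<times> {v})\<^sup>* \<longleftrightarrow> X \<inter> insert v Y \<noteq> {}" (is "_ \<in> ?R\<^sup>* \<longleftrightarrow> _")
proof
  assume "(u, v) \<in> ?R\<^sup>*"
  then obtain x where x: "x \<in> X" and xv: "(x, v) \<in> ?R\<^sup>*"
    using assms by (auto elim: converse_rtranclE)
  from xv have "x \<in> insert v Y"
    by (cases rule: converse_rtranclE) (use x assms in auto)
  with x show "X \<inter> insert v Y \<noteq> {}" by blast
next
  assume "X \<inter> insert v Y \<noteq> {}"
  then obtain x where "x \<in> X" "x = v \<or> x \<in> Y" by blast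
  then have "(u, x) \<in> ?R\<^sup>*" "(x, v) \<in> ?R\<^sup>*" by auto
  then show "(u, v) \<in> ?R\<^sup>*" by (rule rtrancl_trans)
qed

section \<open>Set disjointness instances for the two graph problems\<close>

text \<open>
  The sets \<open>x\<close> of inner nodes give the disjointness instances. The additional member \<open>{n}\<close>, an edge
  to the target itself, keeps the bound positive when \<open>n = 2\<close> and there are no inner nodes.
\<close>

definition disjointness_family :: "nat \<Rightarrow> nat set set" where
  "disjointness_family n = insert {n} (Pow {2..<n})"

lemma finite_disjointness_family: "finite (disjointness_family n)"
  by (simp add: disjointness_family_def)

lemma card_disjointness_family:
  assumes "n \<ge> 2"
  shows "card (disjointness_family n) = 2 ^ (n - 2) + 1"
  using assms by (subst disjointness_family_def, subst card_insert_disjoint) (auto simp: card_Pow)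

lemma disjointness_family_subset:
  assumes "n \<ge> 2" "X \<in> disjointness_family n"
  shows "X \<subseteq> {2..n}"
  using assms by (auto simp: disjointness_family_def)

text \<open>Among subsets of \<open>{2..<n}\<close> the diagonal value is false, while two distinct
  sets have an element in one but not the other, so a mixed value is true. For \<open>{n}\<close>
  the diagonal value is true, which separates it from all the others.\<close>

lemma disjointness_family_fooling:
  assumes "X \<in> disjointness_family n" "Y \<in> disjointness_family n" "X \<noteq> Y"
    and "\<forall>X' \<in> {X, Y}. \<forall>Y' \<in> {X, Y}. r = (X' \<inter> insert n ({2..<n} - Y') \<noteq> {})"
  shows False
  using assms by (auto simp: disjointness_family_def)

lemma reachability_bound:
  assumes "wf_data_structure w D" "memoryless w D" "solves D (reachability n)"
    and "query_time (reachability n) D \<le> enat t" and n: "n \<ge> 2"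
  shows "2 ^ (n - 2) + 1 \<le> (2::nat) ^ (2 * w * t)"
proof -
  \<comment> \<open>\<open>X\<close> is encoded by input edges leaving 1, the complement of
    \<open>Y\<close> by inserted edges entering \<open>n\<close>. The latter start at nodes at least
    2, so they are absent from every input.\<close>
  define us where "us Y = map (\<lambda>i. (i, n)) (sorted_list_of_set ({2..<n} - Y))" for Y
  have us: "set (us Y) = ({2..<n} - Y) \<times> {n}" "distinct (us Y)" for Y
    by (auto simp: us_def distinct_map inj_on_def)
  let ?s = "\<lambda>X. {1} \<times> X"
  have legal: "set (us Y) \<subseteq> ({1..n} \<times> {1..n} - Id) - ?s X" for X Y
    by (auto simp: us)
  have "card (disjointness_family n) \<le> 2 ^ (2 * w * t)"
  proof (rule fooling_set_card[OF assms(1-4)])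
    show "(1, n) \<in> queries (reachability n)"
      using n by (simp add: reachability_def)
    show "?s X \<in> inputs (reachability n)" if "X \<in> disjointness_family n" for X
      using disjointness_family_subset[OF n that] n by (auto simp: reachability_def)
    show "legal_run (reachability n) (?s X) (us Y) (?s X \<union> ({2..<n} - Y) \<times> {n})" for X Y
      using reachability_run[OF us(2) legal] by (simp add: us(1))
    show False if "X \<in> disjointness_family n" "Y \<in> disjointness_family n" "X \<noteq> Y"
      and r: "\<forall>X' \<in> {X, Y}. \<forall>Y' \<in> {X, Y}.
          r \<in> correct_answers (reachability n) (?s X' \<union> ({2..<n} - Y') \<times> {n}) (1, n)" for X Y r
    proof (rule disjointness_family_fooling[OF that(1-3)])
      have "((1, n) \<in> (?s X' \<union> ({2..<n} - Y') \<times> {n})\<^sup>*) = (X' \<inter> insert n ({2..<n} - Y') \<noteq> {})"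
        if "X' \<in> {X, Y}" for X' Y'
        using that disjointness_family_subset[OF n \<open>X \<in> _\<close>] disjointness_family_subset[OF n \<open>Y \<in> _\<close>] n
        by (intro two_layer_reachable_iff) auto
      moreover have "r = ((1, n) \<in> (?s X' \<union> ({2..<n} - Y') \<times> {n})\<^sup>*)"
        if "X' \<in> {X, Y}" "Y' \<in> {X, Y}" for X' Y'
        using r[rule_format, OF that] by (simp add: reachability_def)
      ultimately show "\<forall>X' \<in> {X, Y}. \<forall>Y' \<in> {X, Y}. r = (X' \<inter> insert n ({2..<n} - Y') \<noteq> {})"
        by (intro ballI) metis
    qed
  qed (rule finite_disjointness_family)
  then show ?thesis by (simp add: card_disjointness_family n)
qed

section \<open>Subgraph connectivity\<close>

text \<open>Only switches that change a node's status are legal, so the direction has to follow the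
  current status.\<close>

definition toggle :: "nat set \<Rightarrow> nat \<Rightarrow> switch" where
  "toggle S v = (if v \<in> S then Turn_Off v else Turn_On v)"

lemma subgraph_connectivity_run:
  assumes "distinct vs" "set vs \<subseteq> {1..n}"
  shows "legal_run (subgraph_connectivity n S0) (E, S) (map (toggle S) vs)
    (E, (S - set vs) \<union> (set vs - S))"
  using assms
proof (induction vs arbitrary: S)
  case (Cons v vs)
  let ?S = "apply_switch S (toggle S v)"
  \<comment> \<open>By distinctness, switching \<open>v\<close> leaves the status of later nodes
    alone. The whole update list can therefore be computed from the starting set.\<close>
  have "map (toggle S) vs = map (toggle ?S) vs"
    using Cons.prems by (auto simp: toggle_def)
  moreover have "toggle S v \<in> legal_updates (subgraph_connectivity n S0) (E, S)"
    using Cons.prems by (auto simp: subgraph_connectivity_def toggle_def)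
  moreover have "apply_update (subgraph_connectivity n S0) (E, S) (toggle S v) = (E, ?S)"
    by (simp add: subgraph_connectivity_def)
  moreover have "(?S - set vs) \<union> (set vs - ?S) = (S - set (v # vs)) \<union> (set (v # vs) - S)"
    using Cons.prems(1) by (auto simp: toggle_def)
  moreover have "legal_run (subgraph_connectivity n S0) (E, ?S) (map (toggle ?S) vs)
      (E, (?S - set vs) \<union> (set vs - ?S))"
    by (rule Cons.IH) (use Cons.prems in auto)
  ultimately show ?case by (simp del: map_eq_conv)
qed simp

text \<open>The on neighbours of \<open>u\<close> are exactly \<open>X \<inter> insert v Y\<close>,
  and each of them is \<open>v\<close> or adjacent to \<open>v\<close>. So \<open>u\<close> reaches
  \<open>v\<close> as soon as it has any on neighbour.\<close>

lemma two_layer_connected_iff: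
  assumes "u \<noteq> v" "u \<notin> X" "u \<notin> Z" "v \<notin> Z" "Y \<subseteq> Z"
  shows "connected_within ((\<lambda>i. {u, i}) ` X \<union> (\<lambda>i. {i, v}) ` Z) ({u, v} \<union> Y) u v
    \<longleftrightarrow> X \<inter> insert v Y \<noteq> {}"
proof -
  define S where "S = {u, v} \<union> Y"
  let ?E = "(\<lambda>i. {u, i}) ` X \<union> (\<lambda>i. {i, v}) ` Z"
  let ?R = "{(a, b). {a, b} \<in> ?E \<and> a \<in> S \<and> b \<in> S}"
  have first: "b \<in> X \<inter> insert v Y" if "(u, b) \<in> ?R" for b
    using that assms by (auto simp: doubleton_eq_iff S_def)
  have "(u, v) \<in> ?R\<^sup>* \<longleftrightarrow> X \<inter> insert v Y \<noteq> {}"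
  proof
    assume "(u, v) \<in> ?R\<^sup>*"
    then obtain b where "(u, b) \<in> ?R" using assms(1) by (meson converse_rtranclE)
    then show "X \<inter> insert v Y \<noteq> {}" using first by blast
  next
    assume "X \<inter> insert v Y \<noteq> {}"
    then obtain x where x: "x \<in> X" "x = v \<or> x \<in> Y" by blast
    have "(u, x) \<in> ?R" using x by (auto simp: S_def)
    moreover have "(x, v) \<in> ?R\<^sup>*"
    proof (cases "x = v")
      case False
      then have "(x, v) \<in> ?R" using x assms(5) by (auto simp: S_def)
      then show ?thesis ..
    qed simp
    ultimately show "(u, v) \<in> ?R\<^sup>*" by (rule converse_rtrancl_into_rtrancl)
  qed
  moreover have "u \<in> S" "v \<in> S" by (auto simp: S_def)
  ultimately show ?thesis
    unfolding connected_within_def S_def[symmetric] by blast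
qed

lemma subgraph_connectivity_bound:
  assumes "wf_data_structure w D" "memoryless w D" "solves D (subgraph_connectivity n S0)"
    and "query_time (subgraph_connectivity n S0) D \<le> enat t" and n: "n \<ge> 2" and S0: "S0 \<subseteq> {1..n}"
  shows "2 ^ (n - 2) + 1 \<le> (2::nat) ^ (2 * w * t)"
proof -
  \<comment> \<open>The edges are fixed in the input, so every inner node is joined to
    \<open>n\<close> and \<open>Y\<close> acts only through the on nodes. Toggling the symmetric
    difference of \<open>S0\<close> and \<open>S Y\<close> reaches \<open>S Y\<close> from an
    arbitrary \<open>S0\<close>.\<close>
  define S where "S Y = {1, n} \<union> ({2..<n} - Y)" for Y
  define vs where "vs Y = sorted_list_of_set ((S0 - S Y) \<union> (S Y - S0))" for Y
  define E where "E X = (\<lambda>i. {1, i}) ` X \<union> (\<lambda>i. {i, n}) ` {2..<n}" for X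
  have "finite S0" using S0 finite_subset by blast
  then have vs: "set (vs Y) = (S0 - S Y) \<union> (S Y - S0)" "distinct (vs Y)" for Y
    by (simp_all add: vs_def S_def)
  have range: "set (vs Y) \<subseteq> {1..n}" for Y
    using S0 n by (auto simp: vs S_def)
  have "card (disjointness_family n) \<le> 2 ^ (2 * w * t)"
  proof (rule fooling_set_card[OF assms(1-4)])
    show "(1, n) \<in> queries (subgraph_connectivity n S0)"
      using n by (simp add: subgraph_connectivity_def)
    show "(E X, S0) \<in> inputs (subgraph_connectivity n S0)" if "X \<in> disjointness_family n" for X
      using disjointness_family_subset[OF n that] n
      by (auto simp: subgraph_connectivity_def E_def card_insert_if)
    have "(S0 - set (vs Y)) \<union> (set (vs Y) - S0) = S Y" for Y
      by (auto simp: vs)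
    then show "legal_run (subgraph_connectivity n S0) (E X, S0) (map (toggle S0) (vs Y))
        (E X, S Y)" for X Y
      using subgraph_connectivity_run[OF vs(2) range] by metis
    show False if "X \<in> disjointness_family n" "Y \<in> disjointness_family n" "X \<noteq> Y"
      and r: "\<forall>X' \<in> {X, Y}. \<forall>Y' \<in> {X, Y}.
          r \<in> correct_answers (subgraph_connectivity n S0) (E X', S Y') (1, n)" for X Y r
    proof (rule disjointness_family_fooling[OF that(1-3)])
      have "connected_within (E X') (S Y') 1 n = (X' \<inter> insert n ({2..<n} - Y') \<noteq> {})"
        if "X' \<in> {X, Y}" for X' Y'
        unfolding E_def S_def
        using that disjointness_family_subset[OF n \<open>X \<in> _\<close>] disjointness_family_subset[OF n \<open>Y \<in> _\<close>] n
        by (intro two_layer_connected_iff) auto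
      moreover have "r = connected_within (E X') (S Y') 1 n"
        if "X' \<in> {X, Y}" "Y' \<in> {X, Y}" for X' Y'
        using r[rule_format, OF that] by (simp add: subgraph_connectivity_def)
      ultimately show "\<forall>X' \<in> {X, Y}. \<forall>Y' \<in> {X, Y}. r = (X' \<inter> insert n ({2..<n} - Y') \<noteq> {})"
        by (intro ballI) metis
    qed
  qed (rule finite_disjointness_family)
  then show ?thesis by (simp add: card_disjointness_family n)
qed

section \<open>Range mode\<close>

lemma range_mode_run:
  assumes "distinct ks" "set ks \<subseteq> {1..n}" "\<And>k. k \<in> set ks \<Longrightarrow> A k + d \<in> V"
  shows "legal_run (range_mode n V) A (map (\<lambda>k. (k, d)) ks)
    (\<lambda>k. if k \<in> set ks then A k + d else A k)"
  using assms
proof (induction ks arbitrary: A)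
  case (Cons k ks)
  let ?A = "A(k := A k + d)"
  have "legal_run (range_mode n V) ?A (map (\<lambda>k. (k, d)) ks)
      (\<lambda>k. if k \<in> set ks then ?A k + d else ?A k)"
    by (rule Cons.IH) (use Cons.prems in auto)
  moreover have "(\<lambda>k. if k \<in> set ks then ?A k + d else ?A k) =
      (\<lambda>i. if i \<in> set (k # ks) then A i + d else A i)"
    using Cons.prems(1) by (auto simp: fun_eq_iff)
  moreover have "(k, d) \<in> legal_updates (range_mode n V) A"
      "apply_update (range_mode n V) A (k, d) = ?A"
    using Cons.prems by (auto simp: range_mode_def)
  ultimately show ?case by simp
qed simp

text \<open>
  Element \<open>k\<close> owns the positions \<open>k\<close> and \<open>m + k\<close> and the values \<open>k\<close> and \<open>m + k\<close>. Position \<open>k\<close> holds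
  the value \<open>k\<close> iff \<open>k \<in> X\<close>, and position \<open>m + k\<close> holds the value \<open>k\<close> iff \<open>k \<notin> Y\<close>. So \<open>k\<close> occurs
  twice iff \<open>k \<in> X - Y\<close>, and \<open>m + k\<close> occurs twice iff \<open>k \<in> Y - X\<close>. Swapping \<open>X\<close> and \<open>Y\<close> exchanges
  the two cases, so that for \<open>X \<noteq> Y\<close> the two sets of modes are disjoint.
\<close>

definition split_array :: "nat \<Rightarrow> nat set \<Rightarrow> nat set \<Rightarrow> nat \<Rightarrow> int" where
  "split_array m X Y i =
     (if i \<le> m then (if i \<in> X then int i else int (m + i))
      else (if i - m \<in> Y then int i else int (i - m)))"

definition mode_elements :: "nat \<Rightarrow> nat set \<Rightarrow> nat set \<Rightarrow> int set" where
  "mode_elements m X Y = int ` ({1..m} \<inter> (X - Y)) \<union> (\<lambda>k. int (m + k)) ` ({1..m} \<inter> (Y - X))"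

lemma split_array_occurrences:
  "{i \<in> {1..2 * m}. split_array m X Y i = x} =
     {i. i \<in> {1..m} \<and> (i \<in> X \<and> x = int i \<or> i \<notin> X \<and> x = int (m + i))} \<union>
     (+) m ` {i. i \<in> {1..m} \<and> (i \<in> Y \<and> x = int (m + i) \<or> i \<notin> Y \<and> x = int i)}"
  (is "?L = ?A \<union> _ ` ?B")
proof (intro set_eqI iffI)
  fix i assume i: "i \<in> ?L"
  show "i \<in> ?A \<union> (+) m ` ?B"
  proof (cases "i \<le> m")
    case False
    then have "i - m \<in> ?B" "i = m + (i - m)"
      using i by (auto simp: split_array_def split: if_splits)
    then show ?thesis by blast
  qed (use i in \<open>auto simp: split_array_def split: if_splits\<close>)
qed (auto simp: split_array_def)

lemma split_array_occurrences_mode: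
  assumes "x \<in> mode_elements m X Y"
  shows "card {i \<in> {1..2 * m}. split_array m X Y i = x} = 2"
proof -
  obtain k where k: "k \<in> {1..m}" "k \<in> X \<and> k \<notin> Y \<and> x = int k \<or> k \<in> Y \<and> k \<notin> X \<and> x = int (m + k)"
    using assms by (auto simp: mode_elements_def)
  then have "{i \<in> {1..2 * m}. split_array m X Y i = x} = {k, m + k}"
    unfolding split_array_occurrences by auto
  then show ?thesis using k(1) by simp
qed

text \<open>A value determines its owner \<open>k\<close>, and only the positions \<open>k\<close>
  and \<open>m + k\<close> can hold it. If both do, it is a mode element.\<close>

lemma split_array_occurrences_no_mode:
  assumes "x \<notin> mode_elements m X Y"
  shows "card {i \<in> {1..2 * m}. split_array m X Y i = x} \<le> 1"
proof -
  have "i = j" if "i \<in> {i \<in> {1..2 * m}. split_array m X Y i = x}"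
      "j \<in> {i \<in> {1..2 * m}. split_array m X Y i = x}" for i j
    using that assms unfolding split_array_occurrences mode_elements_def by auto
  then show ?thesis by (simp add: card_le_Suc0_iff_eq)
qed

text \<open>Since \<open>X \<noteq> Y\<close>, some value occurs twice, so every mode must occur at
  least twice.\<close>

lemma range_modes_split_array:
  assumes "X \<subseteq> {1..m}" "Y \<subseteq> {1..m}" "X \<noteq> Y"
  shows "range_modes (split_array m X Y) 1 (2 * m) \<subseteq> mode_elements m X Y"
proof
  fix x assume x: "x \<in> range_modes (split_array m X Y) 1 (2 * m)"
  obtain y where y: "y \<in> mode_elements m X Y"
  proof -
    obtain k where "k \<in> {1..m}" "k \<in> X - Y \<or> k \<in> Y - X"
      using assms by blast
    then show ?thesis using that unfolding mode_elements_def by blast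
  qed
  have "card {i \<in> {1..2 * m}. split_array m X Y i = y} \<le> card {i \<in> {1..2 * m}. split_array m X Y i = x}"
    using x unfolding range_modes_def by simp
  then have "2 \<le> card {i \<in> {1..2 * m}. split_array m X Y i = x}"
    using split_array_occurrences_mode[OF y] by simp
  then show "x \<in> mode_elements m X Y"
    using split_array_occurrences_no_mode[of x m X Y] by linarith
qed

lemma mode_elements_swap: "mode_elements m X Y \<inter> mode_elements m Y X = {}"
  by (auto simp: mode_elements_def)

lemma range_mode_bound:
  assumes "wf_data_structure w D" "memoryless w D" "solves D (range_mode n V)"
    and "query_time (range_mode n V) D \<le> enat t" and n: "n \<ge> 2" and V: "{1..int n} \<subseteq> V"
  shows "2 ^ (n div 2) \<le> (2::nat) ^ (2 * w * t)"
proof -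
  define m where "m = n div 2"
  have m: "1 \<le> m" "2 * m \<le> n" using n by (auto simp: m_def)
  \<comment> \<open>In the input, position \<open>m + k\<close> holds the value
    \<open>m + k\<close>; subtracting \<open>m\<close> for \<open>k\<close> outside \<open>Y\<close>
    turns it into \<open>k\<close>, which yields \<open>split_array m X Y\<close>. If
    \<open>n\<close> is odd, the last position lies outside the queried range and gets the filler 1.
    The value \<open>undefined\<close> makes the array extensional.\<close>
  define s where
    "s X i = (if i \<in> {1..n} then if i \<le> 2 * m then split_array m X {1..m} i else 1 else undefined)"
    for X i
  define ks where "ks Y = sorted_list_of_set ((+) m ` ({1..m} - Y))" for Y
  have ks: "set (ks Y) = (+) m ` ({1..m} - Y)" "distinct (ks Y)" for Y
    by (simp_all add: ks_def)
  define fs where "fs X Y = (\<lambda>k. if k \<in> set (ks Y) then s X k + - int m else s X k)" for X Y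
  have range: "set (ks Y) \<subseteq> {1..n}" for Y
    using m by (auto simp: ks)
  have legal: "s X k + - int m \<in> V" if "k \<in> set (ks Y)" for X Y k
    using that m by (intro subsetD[OF V]) (auto simp: ks s_def split_array_def)
  have fs: "fs X Y i = split_array m X Y i" if "i \<in> {1..2 * m}" for X Y i
  proof (cases "i \<le> m")
    case True
    then show ?thesis using that m by (auto simp: fs_def s_def ks split_array_def)
  next
    case False
    then have k: "i = m + (i - m)" "i - m \<in> {1..m}"
      using that by auto
    then have "i \<in> set (ks Y) \<longleftrightarrow> i - m \<notin> Y"
      using inj_image_mem_iff[of "(+) m" "i - m" "{1..m} - Y"] by (simp add: ks)
    then show ?thesis using False k(2) that m by (auto simp: fs_def s_def split_array_def)
  qed
  have "card (Pow {1..m}) \<le> 2 ^ (2 * w * t)"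
  proof (rule fooling_set_card[OF assms(1-4)])
    show "(1, 2 * m) \<in> queries (range_mode n V)"
      using m by (simp add: range_mode_def)
    have "s X i \<in> V" if "i \<in> {1..n}" for X i
      using that m by (intro subsetD[OF V]) (auto simp: s_def split_array_def)
    then show "s X \<in> inputs (range_mode n V)" for X
      by (auto simp: range_mode_def PiE_iff extensional_def s_def)
    show "legal_run (range_mode n V) (s X) (map (\<lambda>k. (k, - int m)) (ks Y)) (fs X Y)" for X Y
      unfolding fs_def by (rule range_mode_run[OF ks(2) range legal])
    show False if "X \<in> Pow {1..m}" "Y \<in> Pow {1..m}" "X \<noteq> Y"
      and r: "\<forall>X' \<in> {X, Y}. \<forall>Y' \<in> {X, Y}.
          r \<in> correct_answers (range_mode n V) (fs X' Y') (1, 2 * m)" for X Y r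
    proof -
      \<comment> \<open>The two mixed arrays already have no common mode.\<close>
      have "range_modes (fs X Y) 1 (2 * m) = range_modes (split_array m X Y) 1 (2 * m)" for X Y
        using fs[of _ X Y] unfolding range_modes_def by (simp cong: conj_cong)
      then have "r \<in> range_modes (split_array m X Y) 1 (2 * m)"
          "r \<in> range_modes (split_array m Y X) 1 (2 * m)"
        using r by (simp_all add: range_mode_def)
      then have "r \<in> mode_elements m X Y" "r \<in> mode_elements m Y X"
        using range_modes_split_array[of X m Y] range_modes_split_array[of Y m X] that(1-3) by auto
      then show False using mode_elements_swap by blast
    qed
  qed simp
  then show ?thesis by (simp add: card_Pow m_def)
qed

section \<open>The query time bound\<close>

lemma query_time_lower_bound:
  assumes "w \<ge> 1" and bound: "\<And>t. query_time P D \<le> enat t \<Longrightarrow> n \<le> 6 * w * t"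
  shows "ereal (1 / 6 * real n / real w) \<le> ereal_of_enat (query_time P D)"
proof (cases "query_time P D")
  case (enat t)
  then have "n \<le> 6 * w * t" using bound by simp
  then have "real n \<le> 6 * real w * real t"
    by (metis of_nat_le_iff of_nat_mult of_nat_numeral)
  then show ?thesis using assms(1) by (simp add: enat field_simps)
qed simp

theorem corollary2:
  "\<exists>c::real. c > 0 \<and> (\<forall>n w::nat. n \<ge> 2 \<and> w \<ge> 1 \<longrightarrow>
     (\<forall>D. wf_data_structure w D \<and> memoryless w D \<and> solves D (reachability n)
        \<longrightarrow> ereal (c * real n / real w) \<le> ereal_of_enat (query_time (reachability n) D)) \<and>
     (\<forall>S0 D. S0 \<subseteq> {1..n} \<and>
          wf_data_structure w D \<and> memoryless w D \<and> solves D (subgraph_connectivity n S0)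
        \<longrightarrow> ereal (c * real n / real w) \<le> ereal_of_enat (query_time (subgraph_connectivity n S0) D)) \<and>
     (\<forall>V D. {1..int n} \<subseteq> V \<and>
          wf_data_structure w D \<and> memoryless w D \<and> solves D (range_mode n V)
        \<longrightarrow> ereal (c * real n / real w) \<le> ereal_of_enat (query_time (range_mode n V) D)))"
proof -
  have graph: "n \<le> 6 * w * t" if "n \<ge> 2" "2 ^ (n - 2) + 1 \<le> (2::nat) ^ (2 * w * t)" for n w t :: nat
  proof -
    \<comment> \<open>The extra member \<open>{n}\<close> makes the inequality strict, so
      \<open>w * t\<close> is at least 1 and absorbs the loss of 2 in the exponent.\<close>
    have "(2::nat) ^ (n - 2) < 2 ^ (2 * w * t)" using that(2) by linarith
    then have "n - 2 < 2 * w * t" by (rule power_less_imp_less_exp[rotated]) simp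
    then show ?thesis using that(1) by simp
  qed
  have mode: "n \<le> 6 * w * t" if "n \<ge> 2" "2 ^ (n div 2) \<le> (2::nat) ^ (2 * w * t)" for n w t :: nat
  proof -
    have "n div 2 \<le> 2 * (w * t)" using that(2) by (simp add: mult.assoc)
    \<comment> \<open>Equality holds at \<open>n = 3\<close>; together with the factor 2 above this
      gives the constant 6.\<close>
    moreover have "n \<le> 3 * (n div 2)" using that(1) by linarith
    ultimately show ?thesis by simp
  qed
  show ?thesis
  proof (intro exI[of _ "1 / 6"] conjI allI impI; (elim conjE)?)
    fix n w :: nat and D :: "((nat \<times> nat) set, nat \<times> nat, nat \<times> nat, bool) data_structure"
    assume "n \<ge> 2" "w \<ge> 1" "wf_data_structure w D" "memoryless w D" "solves D (reachability n)"
    then show "ereal (1 / 6 * real n / real w) \<le> ereal_of_enat (query_time (reachability n) D)"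
      by (intro query_time_lower_bound graph reachability_bound)
  next
    fix n w S0 and D :: "(nat set set \<times> nat set, switch, nat \<times> nat, bool) data_structure"
    assume "n \<ge> 2" "w \<ge> 1" "S0 \<subseteq> {1..n}" "wf_data_structure w D" "memoryless w D"
      "solves D (subgraph_connectivity n S0)"
    then show "ereal (1 / 6 * real n / real w)
        \<le> ereal_of_enat (query_time (subgraph_connectivity n S0) D)"
      by (intro query_time_lower_bound graph subgraph_connectivity_bound)
  next
    fix n w :: nat and V and D :: "(nat \<Rightarrow> int, nat \<times> int, nat \<times> nat, int) data_structure"
    assume "n \<ge> 2" "w \<ge> 1" "{1..int n} \<subseteq> V" "wf_data_structure w D" "memoryless w D"
      "solves D (range_mode n V)"
    then show "ereal (1 / 6 * real n / real w) \<le> ereal_of_enat (query_time (range_mode n V) D)"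
      by (intro query_time_lower_bound mode range_mode_bound)
  qed simp
qed

end
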